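(* If $n_1, \dots, n_k$ are positive integers with $n_1 \leq n_2 \leq \cdots \leq n_k$, then $B(K_{n_1, \dots, n_k}) = \sum_{i=2}^k n_i$.
   Context: $K_{n_1,\dots,n_k}$ is the complete $k$-partite graph with parts of sizes $n_1,\dots,n_k$. Bodyguards and Presidents is a two-player game on a finite simple graph $G$. One player controls a set of tokens called bodyguards, the other a single token called the president. First all bodyguards are placed on vertices (several may share a vertex), then the president is placed. The players then alternate turns, bodyguards first; on a player's turn, each token they control either moves to an adjacent vertex or stays put. The president is surrounded if every vertex of the open neighbourhood of the president's vertex is occupied by a bodyguard. The bodyguards win if there is a finite time after which, at the end of every bodyguard turn, the president is surrounded; otherwise the president wins. The bodyguard number $B(G)$ is the minimum number of bodyguards that guarantees a win for the bodyguards on $G$ (with $B(G)=0$ for the edgeless graph). *)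

theory Defs
  imports "Graph_Theory.Graph_Theory" "HOL-Library.Disjoint_Sets"
begin

text \<open>
  As in \<^theory>\<open>Graph_Theory.Digraph\<close>, a finite simple graph is a symmetric loop-free digraph
  without parallel arcs (locale \<^locale>\<open>graph\<close>). The predicate below extends
  \<^const>\<open>complete_bipartite_digraph\<close> to any number of parts, indexed by \<open>1, \<dots>, k\<close>.
\<close>

definition complete_multipartite_digraph ::
    "nat \<Rightarrow> (nat \<Rightarrow> nat) \<Rightarrow> ('a, 'b) pre_digraph \<Rightarrow> bool" where
  "complete_multipartite_digraph k n G \<longleftrightarrow> graph G \<and>
     (\<exists>P. verts G = (\<Union>i\<in>{1..k}. P i) \<and> disjoint_family_on P {1..k} \<and>
          (\<forall>i\<in>{1..k}. card (P i) = n i) \<and>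
          arcs_ends G = (\<Union>i\<in>{1..k}. \<Union>j\<in>{1..k} - {i}. P i \<times> P j))"

definition token_trajectory :: "('a, 'b) pre_digraph \<Rightarrow> (nat \<Rightarrow> 'a) \<Rightarrow> bool" where
  "token_trajectory G w \<longleftrightarrow>
     w 0 \<in> verts G \<and> (\<forall>t. w (Suc t) = w t \<or> w t \<rightarrow>\<^bsub>G\<^esub> w (Suc t))"

definition open_neighbourhood :: "('a, 'b) pre_digraph \<Rightarrow> 'a \<Rightarrow> 'a set" where
  "open_neighbourhood G v = {u. v \<rightarrow>\<^bsub>G\<^esub> u}"

definition surrounded :: "('a, 'b) pre_digraph \<Rightarrow> 'a set \<Rightarrow> 'a \<Rightarrow> bool" where
  "surrounded G S v \<longleftrightarrow> open_neighbourhood G v \<subseteq> S"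

text \<open>
  The bodyguards are numbered \<open>0, \<dots>, m - 1\<close>, and a bodyguard strategy \<open>\<sigma>\<close> maps the list of all
  positions taken by the president so far to the next position of each bodyguard; \<open>\<sigma> []\<close> is the
  initial placement. Against the president's trajectory \<open>p\<close> the play is
  \<open>b 0, p 0, b 1, p 1, b 2, p 2, \<dots>\<close> with \<open>b t = \<sigma> [p 0, \<dots>, p (t - 1)]\<close>,
  so at the end of the bodyguards' turn \<open>t + 1\<close> the bodyguards
  are at \<open>b (t + 1)\<close> and the president is at \<open>p t\<close>.
\<close>

definition bodyguards_guarantee_win :: "('a, 'b) pre_digraph \<Rightarrow> nat \<Rightarrow> bool" where
  "bodyguards_guarantee_win G m \<longleftrightarrow>
     (\<exists>\<sigma> :: 'a list \<Rightarrow> nat \<Rightarrow> 'a. \<forall>p. token_trajectory G p \<longrightarrow>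
        (let b = (\<lambda>t. \<sigma> (map p [0..<t])) in
           (\<forall>i<m. token_trajectory G (\<lambda>t. b t i)) \<and>
           (\<exists>T. \<forall>t\<ge>T. surrounded G (b (Suc t) ` {..<m}) (p t))))"

definition bodyguard_number :: "('a, 'b) pre_digraph \<Rightarrow> nat" where
  "bodyguard_number G = (LEAST m. bodyguards_guarantee_win G m)"

text \<open>The minimum exists on every finite graph: one stationary bodyguard per vertex suffices.\<close>

lemma bodyguards_guarantee_win_card_verts:
  assumes "graph G"
  shows "bodyguards_guarantee_win G (card (verts G))"
proof -
  interpret graph G by fact
  obtain f where f: "bij_betw f {..<card (verts G)} (verts G)"
    using ex_bij_betw_nat_finite[OF finite_verts] by (auto simp: atLeast0LessThan)
  have "open_neighbourhood G v \<subseteq> verts G" for v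
    by (auto simp: open_neighbourhood_def)
  then show ?thesis
    using f unfolding bodyguards_guarantee_win_def
    by (intro exI[of _ "\<lambda>_. f"])
       (auto simp: token_trajectory_def surrounded_def Let_def bij_betw_def)
qed

lemma bodyguard_number_edgeless:
  assumes "arcs G = {}"
  shows "bodyguard_number G = 0"
proof -
  have "bodyguards_guarantee_win G 0"
    using assms by (auto simp: bodyguards_guarantee_win_def surrounded_def
        open_neighbourhood_def arcs_ends_def Let_def)
  then show ?thesis
    by (simp add: bodyguard_number_def)
qed

lemma complete_multipartite_digraph_exists:
  "complete_multipartite_digraph k n (with_proj
     \<lparr> pverts = (SIGMA i:{1..k}. {1..n i}),
       parcs = {(u, v). u \<in> (SIGMA i:{1..k}. {1..n i}) \<and> v \<in> (SIGMA i:{1..k}. {1..n i}) \<and>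
                        fst u \<noteq> fst v} \<rparr>)"
  (is "complete_multipartite_digraph k n (with_proj ?G)")
proof -
  have fin: "finite (pverts ?G)" by simp
  have "parcs ?G \<subseteq> pverts ?G \<times> pverts ?G" by auto
  then have "finite (parcs ?G)" using fin by (meson finite_SigmaI finite_subset)
  then have "pair_graph ?G"
    using fin by unfold_locales (auto simp: symmetric_def intro!: symI)
  then have "graph (with_proj ?G)" by (rule pair_graph.pair_graphD_graph)
  then show ?thesis
    unfolding complete_multipartite_digraph_def
    by (intro conjI exI[of _ "\<lambda>i. {i} \<times> {1..n i}"])
       (auto simp: disjoint_family_on_def card_cartesian_product)
qed

end

theory Submission
  imports Defs
begin

text \<open>
  A president who never moves forces at least as many bodyguards as the degree of its vertex, and
  the vertices of a smallest part have degree \<open>n\<^sub>2 + \<dots> + n\<^sub>k\<close>. Conversely, give each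
  vertex \<open>v\<close> outside the first part its own bodyguard, and choose a map onto the first part from
  each other part. While the president is in the part of \<open>v\<close>, the bodyguard of \<open>v\<close> stands at the
  image of \<open>v\<close>, otherwise at \<open>v\<close>. These two vertices are adjacent, so the bodyguard can always
  follow, and every vertex outside the president's part is occupied.
\<close>

lemma card_open_neighbourhood_le:
  assumes "bodyguards_guarantee_win G m" and "v \<in> verts G"
  shows "card (open_neighbourhood G v) \<le> m"
proof -
  have "token_trajectory G (\<lambda>_. v)"
    using assms(2) by (simp add: token_trajectory_def)
  \<comment> \<open>Being surrounded at one late turn is enough: \<open>b\<close> is the placement
    of the bodyguards at that turn.\<close>
  then obtain b :: "nat \<Rightarrow> 'a" where "surrounded G (b ` {..<m}) v"
    using assms(1) unfolding bodyguards_guarantee_win_def Let_def by blast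
  then have "card (open_neighbourhood G v) \<le> card (b ` {..<m})"
    by (intro card_mono) (auto simp: surrounded_def)
  also have "\<dots> \<le> m"
    using card_image_le[of "{..<m}" b] by simp
  finally show ?thesis .
qed

lemma token_trajectory_in_verts:
  assumes "wf_digraph G" and "token_trajectory G p"
  shows "p t \<in> verts G"
proof -
  interpret wf_digraph G by fact
  show ?thesis
  proof (induction t)
    case (Suc t)
    then show ?case using assms(2) adj_in_verts(2) unfolding token_trajectory_def by metis
  qed (use assms(2) in \<open>simp add: token_trajectory_def\<close>)
qed

text \<open>The parts are encoded as the classes of a colouring \<open>c\<close>, so that adjacency
  is just a difference of colours; \<open>a\<close> is the colour of a smallest class.\<close>

lemma bodyguards_guarantee_win_coloured:
  fixes G :: "('a, 'b) pre_digraph" and c :: "'a \<Rightarrow> 'c"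
  assumes wf: "wf_digraph G" and fin: "finite (verts G)"
    and adj: "\<And>u v. u \<rightarrow>\<^bsub>G\<^esub> v \<longleftrightarrow> u \<in> verts G \<and> v \<in> verts G \<and> c u \<noteq> c v"
    and card_le: "\<And>i. i \<in> c ` verts G \<Longrightarrow>
      card {v \<in> verts G. c v = a} \<le> card {v \<in> verts G. c v = i}"
    and ne: "a \<in> c ` verts G"
  shows "bodyguards_guarantee_win G (card {v \<in> verts G. c v \<noteq> a})"
proof -
  define A where "A = {v \<in> verts G. c v = a}"
  define W where "W = {v \<in> verts G. c v \<noteq> a}"
  have "finite W" using fin by (simp add: W_def)
  then obtain h where h: "bij_betw h {..<card W} W"
    using ex_bij_betw_nat_finite by (metis atLeast0LessThan)
  \<comment> \<open>The class of \<open>i\<close> is at least as large as \<open>A\<close>, so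
    \<open>A\<close> injects into it; since \<open>A\<close> is nonempty, such an injection can be
    reversed to a surjection onto \<open>A\<close>.\<close>
  have "\<exists>s. s ` {v \<in> verts G. c v = i} = A" if "i \<in> c ` verts G" for i
  proof -
    have "\<exists>f. inj_on f A \<and> f ` A \<subseteq> {v \<in> verts G. c v = i}"
      using card_le[OF that] fin by (subst inj_on_iff_card_le) (auto simp: A_def)
    moreover have "A \<noteq> {}" using ne by (auto simp: A_def)
    ultimately show ?thesis by (simp add: inj_on_iff_surj)
  qed
  then obtain s where s: "\<And>i. i \<in> c ` verts G \<Longrightarrow> s i ` {v \<in> verts G. c v = i} = A"
    by metis
  \<comment> \<open>Post of the bodyguard of \<open>v\<close> while the president is at
    \<open>x\<close>. If \<open>c x = a\<close>, every bodyguard with \<open>v\<close> in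
    \<open>W\<close> is at home.\<close>
  define pos where "pos x v = (if c v = c x then s (c x) v else v)" for x v
  have pos_A: "pos x v \<in> A \<or> pos x v = v" if "v \<in> W" for x v
    using that s[of "c v"] by (auto simp: pos_def W_def)
  \<comment> \<open>A post in \<open>A\<close> can only be \<open>s (c v) v\<close>, as
    \<open>v\<close> itself lies outside \<open>A\<close>. So each bodyguard has just two posts, and
    these are adjacent.\<close>
  have pos_eq: "pos x v = pos y v" if "v \<in> W" "pos x v \<in> A" "pos y v \<in> A" for x y v
    using that by (auto simp: pos_def A_def W_def split: if_splits)
  have adj_AW: "u \<rightarrow>\<^bsub>G\<^esub> w \<and> w \<rightarrow>\<^bsub>G\<^esub> u" if "u \<in> A" "w \<in> W" for u w
    using that by (auto simp: adj A_def W_def)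
  have move: "pos y v = pos x v \<or> pos x v \<rightarrow>\<^bsub>G\<^esub> pos y v" if "v \<in> W" for x y v
    using that pos_A pos_eq adj_AW by metis
  have move_0: "pos y v = v \<or> v \<rightarrow>\<^bsub>G\<^esub> pos y v" if "v \<in> W" for y v
    using that pos_A adj_AW by metis
  have cover: "surrounded G (pos x ` W) x" if x: "x \<in> verts G" for x
    unfolding surrounded_def
  proof
    fix u assume "u \<in> open_neighbourhood G x"
    then have u: "u \<in> verts G" "c u \<noteq> c x" by (auto simp: open_neighbourhood_def adj)
    show "u \<in> pos x ` W"
    proof (cases "c u = a")
      case True
      \<comment> \<open>Here the president is outside \<open>A\<close>, so the bodyguards of its own
        class lie in \<open>W\<close> and, by surjectivity of \<open>s (c x)\<close>, cover all of
        \<open>A\<close>.\<close>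
      then obtain w where "w \<in> verts G" "c w = c x" "u = s (c x) w"
        using u x s[of "c x"] by (auto simp: A_def)
      then show ?thesis
        using u True by (auto simp: pos_def W_def intro!: image_eqI[of _ _ w])
    next
      case False
      then show ?thesis
        using u by (auto simp: pos_def W_def intro!: image_eqI[of _ _ u])
    qed
  qed
  \<comment> \<open>Only the president's latest position matters. Before the president is placed the
    bodyguards wait at home, and from their first move on they surround it at every turn.\<close>
  define \<sigma> where "\<sigma> xs i = (if xs = [] then h i else pos (last xs) (h i))" for xs i
  have \<sigma>_0: "\<sigma> (map p [0..<0]) i = h i" for p i by (simp add: \<sigma>_def)
  have \<sigma>_Suc: "\<sigma> (map p [0..<Suc t]) i = pos (p t) (h i)" for p t i by (simp add: \<sigma>_def)
  have "token_trajectory G (\<lambda>t. \<sigma> (map p [0..<t]) i)" if "i < card W" for p i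
  proof -
    have hi: "h i \<in> W" using h that by (auto simp: bij_betw_def)
    have "\<sigma> (map p [0..<Suc t]) i = \<sigma> (map p [0..<t]) i \<or>
        \<sigma> (map p [0..<t]) i \<rightarrow>\<^bsub>G\<^esub> \<sigma> (map p [0..<Suc t]) i" for t
      \<comment> \<open>The first move starts from home rather than from a post chosen for some
        president position, hence the separate \<open>move_0\<close>.\<close>
      using move[OF hi] move_0[OF hi] by (cases t) (auto simp only: \<sigma>_0 \<sigma>_Suc)
    then show ?thesis
      using hi by (simp only: token_trajectory_def \<sigma>_0) (simp add: W_def)
  qed
  moreover have "surrounded G (\<sigma> (map p [0..<Suc t]) ` {..<card W}) (p t)"
    if "token_trajectory G p" for p t
  proof -
    have "\<sigma> (map p [0..<Suc t]) ` {..<card W} = pos (p t) ` W"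
      using bij_betw_imp_surj_on[OF h]
      by (simp add: \<sigma>_Suc image_image[symmetric, of _ h] del: upt_Suc)
    then show ?thesis
      using cover token_trajectory_in_verts[OF wf that] by simp
  qed
  ultimately have "bodyguards_guarantee_win G (card W)"
    unfolding bodyguards_guarantee_win_def Let_def by blast
  then show ?thesis by (simp add: W_def)
qed

theorem theorem3p2:
  fixes G :: "('a, 'b) pre_digraph" and k :: nat and n :: "nat \<Rightarrow> nat"
  assumes "1 \<le> k"
    and "\<And>i. i \<in> {1..k} \<Longrightarrow> 0 < n i"
    and "\<And>i j. 1 \<le> i \<Longrightarrow> i \<le> j \<Longrightarrow> j \<le> k \<Longrightarrow> n i \<le> n j"
    and "complete_multipartite_digraph k n G"
  shows "bodyguard_number G = (\<Sum>i=2..k. n i)"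
proof -
  obtain P where "graph G" and V: "verts G = (\<Union>i\<in>{1..k}. P i)"
    and disj: "disjoint_family_on P {1..k}"
    and card_P: "\<And>i. i \<in> {1..k} \<Longrightarrow> card (P i) = n i"
    and E: "arcs_ends G = (\<Union>i\<in>{1..k}. \<Union>j\<in>{1..k} - {i}. P i \<times> P j)"
    using assms(4) unfolding complete_multipartite_digraph_def by blast
  interpret graph G by fact
  \<comment> \<open>Disjointness of the parts makes this description unique on vertices; elsewhere
    the value is arbitrary, so \<open>adj\<close> states membership in \<open>verts G\<close>
    explicitly.\<close>
  define c where "c v = (THE i. i \<in> {1..k} \<and> v \<in> P i)" for v
  have c_eq: "c v = i" if "i \<in> {1..k}" "v \<in> P i" for v i
    unfolding c_def using that disj
    by (intro the_equality) (auto simp only: disjoint_family_on_def)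
  have P_eq: "{v \<in> verts G. c v = i} = P i" if "i \<in> {1..k}" for i
    using that c_eq by (auto simp: V)
  have c_in: "c v \<in> {1..k}" if "v \<in> verts G" for v
    using that c_eq by (auto simp: V)
  have adj: "u \<rightarrow>\<^bsub>G\<^esub> v \<longleftrightarrow> u \<in> verts G \<and> v \<in> verts G \<and> c u \<noteq> c v" for u v
  proof
    assume "u \<rightarrow>\<^bsub>G\<^esub> v"
    then show "u \<in> verts G \<and> v \<in> verts G \<and> c u \<noteq> c v"
      using c_eq by (fastforce simp: E V)
  next
    assume *: "u \<in> verts G \<and> v \<in> verts G \<and> c u \<noteq> c v"
    then have "c u \<in> {1..k}" "c v \<in> {1..k} - {c u}" "(u, v) \<in> P (c u) \<times> P (c v)"
      using c_in[of u] c_in[of v] P_eq[of "c u"] P_eq[of "c v"] by auto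
    then show "u \<rightarrow>\<^bsub>G\<^esub> v" unfolding E by (intro UN_I)
  qed
  have fin: "finite (P i)" if "i \<in> {1..k}" for i
    using that finite_verts by (simp add: V)
  have "P 1 \<noteq> {}" using card_P[of 1] assms(1) assms(2)[of 1] by auto
  then obtain v where v: "v \<in> P 1" by blast
  have c_v: "v \<in> verts G" "c v = 1" using v c_eq[of 1 v] assms(1) by (auto simp: V)
  \<comment> \<open>This set counts for both bounds: it indexes the bodyguards in the strategy and
    is the neighbourhood of \<open>v\<close>.\<close>
  have "{u \<in> verts G. c u \<noteq> 1} = (\<Union>i\<in>{2..k}. P i)"
  proof (intro equalityI subsetI)
    fix u assume u: "u \<in> {u \<in> verts G. c u \<noteq> 1}"
    then have "u \<in> P (c u)" "c u \<in> {2..k}"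
      using c_in[of u] P_eq[of "c u"] by auto
    then show "u \<in> (\<Union>i\<in>{2..k}. P i)" by blast
  next
    fix u assume "u \<in> (\<Union>i\<in>{2..k}. P i)"
    then obtain i where "i \<in> {2..k}" "u \<in> P i" by blast
    then show "u \<in> {u \<in> verts G. c u \<noteq> 1}" using c_eq[of i u] by (auto simp: V)
  qed
  also have "card \<dots> = (\<Sum>i=2..k. card (P i))"
    using disj fin by (intro card_UN_disjoint) (auto simp: disjoint_family_on_def)
  also have "\<dots> = (\<Sum>i=2..k. n i)"
    using card_P by (intro sum.cong) auto
  finally have card_W: "card {u \<in> verts G. c u \<noteq> 1} = (\<Sum>i=2..k. n i)" .
  \<comment> \<open>The ordering of the part sizes enters here, making part 1 a smallest
    class.\<close>
  have "card {u \<in> verts G. c u = 1} \<le> card {u \<in> verts G. c u = i}"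
    if "i \<in> c ` verts G" for i
  proof -
    have "i \<in> {1..k}" using that c_in by blast
    then show ?thesis using P_eq card_P assms(1) assms(3)[of 1 i] by simp
  qed
  then have "bodyguards_guarantee_win G (\<Sum>i=2..k. n i)"
    using bodyguards_guarantee_win_coloured[OF wf_digraph_axioms finite_verts adj, of 1]
      image_eqI[of 1 c v] c_v card_W by simp
  moreover have "(\<Sum>i=2..k. n i) \<le> m" if "bodyguards_guarantee_win G m" for m
  proof -
    have "open_neighbourhood G v = {u \<in> verts G. c u \<noteq> 1}"
      using c_v by (auto simp: open_neighbourhood_def adj)
    then show ?thesis
      using card_open_neighbourhood_le[OF that c_v(1)] card_W by simp
  qed
  ultimately show ?thesis
    unfolding bodyguard_number_def by (rule Least_equality)
qed

end
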